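(* Let $n\geq 4$ be an even integer, let $k\geq 3$ be an odd integer, and let $G$ be a connected graph of order $n$. (1) If $n \geq 10$ and $e(G)\geq \binom{n-1}{2}+1$, then $G$ is $\mathrm{GBC}_k$ unless $G = K_1 \vee (K_{n-2}+K_1)$. (2) If $4\leq n \leq 6$ and $e(G)\geq \frac{3n^2-2n}{8}$, then $G$ is $\mathrm{GBC}_k$ unless $G = K_{\frac{n}{2}} \vee \frac{n}{2}K_1$. (3) If $n=8$ and $e(G)\geq 22$, then $G$ is $\mathrm{GBC}_k$ unless $G = K_4 \vee 4K_1$ or $G = K_1 \vee (K_6+K_1)$.
   Context: All graphs are finite, simple and undirected. The order of $G$ is its number of vertices and $e(G)$ is its number of edges. $K_m$ is the complete graph on $m$ vertices, $G_1+G_2$ is the (vertex-disjoint) union, $mK_1$ is the graph consisting of $m$ isolated vertices, and the join $G_1\vee G_2$ is obtained from vertex-disjoint $G_1,G_2$ by adding all edges between $V(G_1)$ and $V(G_2)$. Equality of graphs means isomorphism. For a graph $H$, let $\mathrm{odd}(H)$ be the number of nontrivial odd components of $H$ (connected components with an odd number, at least $3$, of vertices) and $i(H)$ the number of isolated vertices of $H$. For odd $k$ define $$\mathrm{def}_k(G)=\max_{S\subseteq V(G)}\{\mathrm{odd}(G-S)+k\cdot i(G-S)-k|S|\}.$$ A $k$-barrier of $G$ is a subset $S\subseteq V(G)$ attaining this maximum. A graph $G$ of even order is generalized bicritical, written $\mathrm{GBC}_k$, if $\emptyset$ is its only $k$-barrier. *)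

theory Defs
  imports Complex_Main "Graph_Theory.Graph_Theory"
begin

text \<open>
  A finite simple undirected graph is a digraph satisfying the library locale \<open>graph\<close>:
  finite, symmetric, without loops and without parallel arcs. Each undirected edge is thus
  represented by two arcs, which is why edges are counted as unordered pairs of endpoints.
\<close>

definition num_edges :: "('a, 'b) pre_digraph \<Rightarrow> nat" where
  "num_edges G = card ((\<lambda>(u, v). {u, v}) ` arcs_ends G)"

definition delete_verts :: "('a, 'b) pre_digraph \<Rightarrow> 'a set \<Rightarrow> ('a, 'b) pre_digraph" where
  "delete_verts G S = G \<restriction> (verts G - S)"

definition components :: "('a, 'b) pre_digraph \<Rightarrow> ('a, 'b) pre_digraph set" where
  "components H = {C. pre_digraph.max_subgraph H connected C}"

definition num_odd :: "('a, 'b) pre_digraph \<Rightarrow> nat" where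
  "num_odd H = card {C \<in> components H. odd (card (verts C)) \<and> card (verts C) \<ge> 3}"

definition num_isolated :: "('a, 'b) pre_digraph \<Rightarrow> nat" where
  "num_isolated H = card {v \<in> verts H. \<not> (\<exists>u. v \<rightarrow>\<^bsub>H\<^esub> u)}"

definition barrier_value :: "nat \<Rightarrow> ('a, 'b) pre_digraph \<Rightarrow> 'a set \<Rightarrow> int" where
  "barrier_value k G S =
     int (num_odd (delete_verts G S)) + int k * int (num_isolated (delete_verts G S))
       - int k * int (card S)"

definition deficiency :: "nat \<Rightarrow> ('a, 'b) pre_digraph \<Rightarrow> int" where
  "deficiency k G = Max (barrier_value k G ` Pow (verts G))"

definition is_barrier :: "nat \<Rightarrow> ('a, 'b) pre_digraph \<Rightarrow> 'a set \<Rightarrow> bool" where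
  "is_barrier k G S \<longleftrightarrow> S \<subseteq> verts G \<and> barrier_value k G S = deficiency k G"

definition GBC :: "nat \<Rightarrow> ('a, 'b) pre_digraph \<Rightarrow> bool" where
  "GBC k G \<longleftrightarrow> even (card (verts G)) \<and> {S. is_barrier k G S} = {{}}"

definition complete_graph :: "nat \<Rightarrow> nat pair_pre_digraph" where
  "complete_graph m = \<lparr> pverts = {..<m}, parcs = {(i, j). i < m \<and> j < m \<and> i \<noteq> j} \<rparr>"

definition empty_graph :: "nat \<Rightarrow> nat pair_pre_digraph" where
  "empty_graph m = \<lparr> pverts = {..<m}, parcs = {} \<rparr>"

text \<open>Vertex-disjointness is enforced by taking the sum of the two vertex types.\<close>

definition disjoint_union ::
  "'a pair_pre_digraph \<Rightarrow> 'b pair_pre_digraph \<Rightarrow> ('a + 'b) pair_pre_digraph" where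
  "disjoint_union G H =
     \<lparr> pverts = pverts G <+> pverts H,
       parcs = map_prod Inl Inl ` parcs G \<union> map_prod Inr Inr ` parcs H \<rparr>"

definition graph_join ::
  "'a pair_pre_digraph \<Rightarrow> 'b pair_pre_digraph \<Rightarrow> ('a + 'b) pair_pre_digraph" where
  "graph_join G H =
     \<lparr> pverts = pverts G <+> pverts H,
       parcs = parcs (disjoint_union G H)
         \<union> (Inl ` pverts G) \<times> (Inr ` pverts H) \<union> (Inr ` pverts H) \<times> (Inl ` pverts G) \<rparr>"

lemma complete_digraph_complete_graph: "K\<^bsub>m\<^esub> (with_proj (complete_graph m))"
  unfolding complete_digraph_pair_def by (auto simp: complete_graph_def)

lemma pair_graph_empty_graph: "pair_graph (empty_graph m)"
  by unfold_locales (auto simp: empty_graph_def symmetric_def sym_def)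

lemma pair_graph_iff:
  "pair_graph G \<longleftrightarrow> finite (pverts G) \<and> parcs G \<subseteq> pverts G \<times> pverts G \<and>
     (\<forall>u v. (u, v) \<in> parcs G \<longrightarrow> (v, u) \<in> parcs G \<and> u \<noteq> v)"
proof
  assume "pair_graph G"
  then interpret pair_graph G .
  show "finite (pverts G) \<and> parcs G \<subseteq> pverts G \<times> pverts G \<and>
     (\<forall>u v. (u, v) \<in> parcs G \<longrightarrow> (v, u) \<in> parcs G \<and> u \<noteq> v)"
    using sym_arcs pair_finite_verts
    by (auto simp: symmetric_def dest: symD arc_fst_in_verts arc_snd_in_verts pair_no_loops)
next
  assume A: "finite (pverts G) \<and> parcs G \<subseteq> pverts G \<times> pverts G \<and>
     (\<forall>u v. (u, v) \<in> parcs G \<longrightarrow> (v, u) \<in> parcs G \<and> u \<noteq> v)"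
  then have "finite (parcs G)"
    by (blast intro: finite_subset finite_cartesian_product)
  with A show "pair_graph G"
    by unfold_locales (auto simp: symmetric_def sym_def)
qed

lemma pair_graph_disjoint_union:
  assumes "pair_graph G" "pair_graph H"
  shows "pair_graph (disjoint_union G H)"
proof -
  let ?P = "parcs (disjoint_union G H)"
  have fin: "finite (pverts (disjoint_union G H))"
    using assms by (simp add: pair_graph_iff disjoint_union_def)
  have mem: "(u, v) \<in> ?P \<longleftrightarrow>
      (\<exists>a b. u = Inl a \<and> v = Inl b \<and> (a, b) \<in> parcs G) \<or>
      (\<exists>a b. u = Inr a \<and> v = Inr b \<and> (a, b) \<in> parcs H)" for u v
    by (auto simp: disjoint_union_def)
  have sub: "?P \<subseteq> pverts (disjoint_union G H) \<times> pverts (disjoint_union G H)"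
    using assms by (auto simp: pair_graph_iff disjoint_union_def)
  have "(v, u) \<in> ?P \<and> u \<noteq> v" if "(u, v) \<in> ?P" for u v
    using that assms unfolding mem pair_graph_iff by blast
  with fin sub show ?thesis unfolding pair_graph_iff by blast
qed

lemma pair_graph_graph_join:
  assumes "pair_graph G" "pair_graph H"
  shows "pair_graph (graph_join G H)"
proof -
  let ?U = "disjoint_union G H"
  let ?C = "(Inl ` pverts G) \<times> (Inr ` pverts H) \<union> (Inr ` pverts H) \<times> (Inl ` pverts G)"
  have U: "pair_graph ?U"
    using assms by (rule pair_graph_disjoint_union)
  have V: "pverts (graph_join G H) = pverts ?U"
    by (simp add: graph_join_def disjoint_union_def)
  have E: "parcs (graph_join G H) = parcs ?U \<union> ?C"
    by (simp add: graph_join_def Un_assoc)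
  have "?C \<subseteq> pverts ?U \<times> pverts ?U"
    by (auto simp: disjoint_union_def)
  moreover have "(v, u) \<in> ?C \<and> u \<noteq> v" if "(u, v) \<in> ?C" for u v
    using that by blast
  ultimately show ?thesis
    using U unfolding pair_graph_iff V E by blast
qed

end

theory Submission
  imports Defs
begin

text \<open>If \<open>G\<close> is not \<open>GBC\<^sub>k\<close>, some nonempty \<open>S\<close> satisfies \<open>q + k i \<ge> k s\<close>, where \<open>s = |S|\<close> and \<open>i\<close>, \<open>q\<close> count the
  isolated vertices and the nontrivial odd components of \<open>G - S\<close>. If \<open>i \<ge> s\<close>, then \<open>s\<close> isolated
  vertices of \<open>G - S\<close> show that \<open>G\<close> is a spanning subgraph of \<open>K\<^sub>s \<or> (K\<^bsub>n-2s\<^esub> + s K\<^sub>1)\<close>. The number of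
  edges of that join is convex in \<open>s \<in> [1, n/2]\<close>, hence at most its value at \<open>s = 1\<close> or \<open>s = n/2\<close>,
  which yields the exceptional graphs. If \<open>i < s\<close>, then \<open>q \<ge> 3\<close>, and separating one odd component
  from the rest of \<open>G - S\<close> already costs too many edges.\<close>

section \<open>Components\<close>

text \<open>Maximal subgraphs with an \<open>arc_mono\<close> property are induced. This makes
  components induced subgraphs, which is how they inherit symmetry in the next lemma.\<close>

lemma arc_mono_connected: "arc_mono connected"
  unfolding arc_mono_def
  by (metis spanning_def subgraphE wf_digraph.connected_spanning_imp_connected)

text \<open>A component inherits symmetry from the graph, and for symmetric digraphs connected means
  strongly connected. The inclusion gives access to the facts on strongly connected components:
  finiteness, disjointness, and the description by reachability.\<close>

lemma (in sym_digraph) components_subset_sccs: "components G \<subseteq> sccs"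
proof
  fix C assume "C \<in> components G"
  then have max: "max_subgraph connected C"
    by (simp add: components_def)
  then have ind: "induced_subgraph C G" and con: "connected C"
    using arc_mono_connected by (auto intro: induced_subgraphI_arc_mono dest: max_subgraph_prop)
  then have sub: "subgraph C G"
    by blast
  interpret C: wf_digraph C
    using ind by (rule wf_digraphI_induced)
  have "symmetric C"
    using sym_arcs ind by (rule induced_graph_imp_symmetric)
  then have "strongly_connected C"
    using con by (rule C.symmetric_connected_imp_strongly_connected)
  \<comment> \<open>A strongly connected \<open>D\<close> would also be connected, against the
    maximality of \<open>C\<close>.\<close>
  moreover have "\<not> strongly_connected D" if "C \<noteq> D" "subgraph C D" "subgraph D G" for D
  proof
    assume D: "strongly_connected D"
    interpret D: wf_digraph D
      using that by auto
    have "connected D"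
      using D by (intro D.connectedI) (auto simp: strongly_connected_def intro: D.reachable_mk_symmetricI)
    with that max show False
      by (auto simp: max_subgraph_def)
  qed
  ultimately have "max_subgraph strongly_connected C"
    using sub by (intro max_subgraphI)
  then show "C \<in> sccs"
    by (simp add: sccs_altdef2)
qed

text \<open>Vertex sets replace the component subgraphs so that the counting takes place among
  subsets of \<open>verts H\<close>. The number is the same because distinct strongly connected
  components have distinct vertex sets.\<close>

definition odd_vertex_sets :: "('a, 'b) pre_digraph \<Rightarrow> 'a set set" where
  "odd_vertex_sets H = {A \<in> verts ` components H. odd (card A) \<and> card A \<ge> 3}"

definition isolated_verts :: "('a, 'b) pre_digraph \<Rightarrow> 'a set" where
  "isolated_verts H = {v \<in> verts H. \<not> (\<exists>u. v \<rightarrow>\<^bsub>H\<^esub> u)}"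

lemma (in sym_digraph) num_odd_eq_card: "num_odd G = card (odd_vertex_sets G)"
proof -
  have "odd_vertex_sets G = verts ` {C \<in> components G. odd (card (verts C)) \<and> card (verts C) \<ge> 3}"
    by (auto simp: odd_vertex_sets_def)
  moreover have "inj_on verts {C \<in> components G. odd (card (verts C)) \<and> card (verts C) \<ge> 3}"
    using components_subset_sccs by (auto intro: inj_on_subset[OF inj_on_verts_sccs])
  ultimately show ?thesis
    by (simp add: num_odd_def card_image)
qed

lemma (in sym_digraph) odd_vertex_sets_subset: "odd_vertex_sets G \<subseteq> sccs_verts"
  using components_subset_sccs by (auto simp: odd_vertex_sets_def sccs_verts_conv)

text \<open>By symmetry an arc can be traversed back, so its two ends lie in the same strongly
  connected component.\<close>

lemma (in sym_digraph) odd_vertex_set_closed: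
  assumes "A \<in> odd_vertex_sets G" "u \<in> A" "u \<rightarrow> v"
  shows "v \<in> A"
proof -
  have "A \<in> sccs_verts"
    using assms odd_vertex_sets_subset by auto
  moreover have "u \<rightarrow>\<^sup>* v"
    using assms by auto
  moreover from this have "v \<rightarrow>\<^sup>* u"
    by (rule symmetric_reachable[OF sym_arcs])
  ultimately show ?thesis
    using assms by (auto simp: in_sccs_verts_conv_reachable)
qed

text \<open>An odd component of order at least three has a second vertex, and a path to it from
  \<open>u\<close> begins with an arc leaving \<open>u\<close>.\<close>

lemma (in sym_digraph) odd_vertex_sets_isolated_disjoint:
  assumes "A \<in> odd_vertex_sets G"
  shows "A \<inter> isolated_verts G = {}"
proof (rule ccontr)
  assume "A \<inter> isolated_verts G \<noteq> {}"
  then obtain u where u: "u \<in> A" "u \<in> isolated_verts G"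
    by blast
  have "\<not> A \<subseteq> {u}"
    using assms card_mono[of "{u}" A] by (auto simp: odd_vertex_sets_def)
  then obtain v where v: "v \<in> A" "v \<noteq> u"
    by blast
  have "A \<in> sccs_verts"
    using assms odd_vertex_sets_subset by auto
  then have "u \<rightarrow>\<^sup>* v"
    using u v by (auto simp: in_sccs_verts_conv_reachable)
  then have "\<exists>w. u \<rightarrow> w"
    using v(2) by (cases rule: converse_reachable_cases) auto
  with u show False
    by (auto simp: isolated_verts_def)
qed

lemma (in pseudo_graph) finite_odd_vertex_sets: "finite (odd_vertex_sets G)"
  using odd_vertex_sets_subset finite_sccs_verts by (rule finite_subset)

lemma (in pseudo_graph) odd_isolated_card_le:
  \<comment> \<open>The odd components are pairwise disjoint, have at least three vertices each, and
    avoid the isolated vertices.\<close>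
  "3 * card (odd_vertex_sets G) + card (isolated_verts G) \<le> card (verts G)"
proof -
  let ?D = "odd_vertex_sets G" and ?I = "isolated_verts G"
  have sub: "\<Union>?D \<subseteq> verts G"
    using odd_vertex_sets_subset sccs_verts_subsets by blast
  then have fin: "finite (\<Union>?D)"
    by (rule finite_subset) simp
  have "card (\<Union>?D) = (\<Sum>A\<in>?D. card A)"
  proof (rule card_Union_disjoint)
    show "pairwise disjnt ?D"
      using odd_vertex_sets_subset sccs_verts_disjoint by (auto simp: pairwise_def disjnt_def)
    show "finite A" if "A \<in> ?D" for A
      using fin that by (meson Union_upper finite_subset)
  qed
  moreover have "(\<Sum>A\<in>?D. 3) \<le> (\<Sum>A\<in>?D. card A)"
    by (rule sum_mono) (auto simp: odd_vertex_sets_def)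
  ultimately have "3 * card ?D \<le> card (\<Union>?D)"
    by simp
  moreover have "card (\<Union>?D \<union> ?I) = card (\<Union>?D) + card ?I"
    using fin odd_vertex_sets_isolated_disjoint
    by (intro card_Un_disjoint) (auto simp: isolated_verts_def)
  moreover have "card (\<Union>?D \<union> ?I) \<le> card (verts G)"
    using sub by (intro card_mono) (auto simp: isolated_verts_def)
  ultimately show ?thesis
    by linarith
qed

section \<open>Barriers\<close>

lemma (in graph) graph_delete_verts: "graph (delete_verts G S)"
proof -
  have ind: "induced_subgraph (delete_verts G S) G"
    unfolding delete_verts_def by (intro induced_induce) auto
  interpret H: wf_digraph "delete_verts G S"
    using ind by (rule wf_digraphI_induced)
  have "symmetric (delete_verts G S)"
    using sym_arcs ind by (rule induced_graph_imp_symmetric)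
  then show ?thesis
    using no_loops no_multi_arcs
    by unfold_locales (auto simp: delete_verts_def arc_to_ends_def)
qed

lemma delete_verts_dominates:
  "u \<rightarrow>\<^bsub>delete_verts G S\<^esub> v \<longleftrightarrow> u \<in> verts G - S \<and> v \<in> verts G - S \<and> u \<rightarrow>\<^bsub>G\<^esub> v"
  by (auto simp: delete_verts_def arcs_ends_def arc_to_ends_def)

text \<open>Parity does all the work: the only component is the whole graph, of even order, and an
  isolated vertex in a connected graph would make the order 1.\<close>

lemma (in graph) barrier_value_empty:
  assumes "connected G" "even (card (verts G))"
  shows "barrier_value k G {} = 0"
proof -
  have del: "delete_verts G {} = G"
    by (intro pre_digraph.equality) (auto simp: delete_verts_def)
  have sc: "strongly_connected G"
    using sym_arcs assms(1) by (rule symmetric_connected_imp_strongly_connected)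
  then have "sccs_verts = {verts G}"
    by (simp add: strongly_connected_eq_iff sccs_verts_conv)
  then have "odd_vertex_sets G = {}"
    using odd_vertex_sets_subset assms(2) by (auto simp: odd_vertex_sets_def)
  moreover have "isolated_verts G = {}"
  proof (rule ccontr)
    assume "isolated_verts G \<noteq> {}"
    then obtain u where u: "u \<in> verts G" "\<not> (\<exists>v. u \<rightarrow> v)"
      by (auto simp: isolated_verts_def)
    have "verts G \<noteq> {u}"
      using assms(2) by auto
    then obtain v where v: "v \<in> verts G" "v \<noteq> u"
      using u by blast
    then have "u \<rightarrow>\<^sup>* v"
      using sc u by auto
    then show False
      using v(2) u(2) by (cases rule: converse_reachable_cases) auto
  qed
  ultimately show ?thesis
    unfolding barrier_value_def del num_odd_eq_card num_isolated_def
    by (simp add: isolated_verts_def)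
qed

text \<open>Since the empty set has value 0, it is the unique maximiser as soon as all other values
  are negative. Contraposition later yields a nonempty \<open>S\<close> of nonnegative
  value.\<close>

lemma (in graph) GBC_I:
  assumes "connected G" "even (card (verts G))"
    and neg: "\<And>S. S \<subseteq> verts G \<Longrightarrow> S \<noteq> {} \<Longrightarrow> barrier_value k G S < 0"
  shows "GBC k G"
proof -
  have "barrier_value k G {} = 0"
    using assms(1,2) by (rule barrier_value_empty)
  moreover from this have "deficiency k G = 0"
    unfolding deficiency_def
    by (intro Max_eqI) (auto simp: image_iff, metis neg order.strict_implies_order order.refl)
  ultimately have "is_barrier k G S \<longleftrightarrow> S = {}" for S
    using neg[of S] by (cases "S = {}") (auto simp: is_barrier_def)
  then show ?thesis
    using assms(2) by (simp add: GBC_def)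
qed

text \<open>If \<open>G - S\<close> has \<open>i < |S|\<close> isolated vertices, then it has \<open>q \<ge> 3(|S| - i)\<close> odd components of
  order at least three, and \<open>|S| + i + 3q \<le> |V|\<close> gives the two numerical bounds.\<close>

lemma (in graph) nonneg_barrier_value_cases:
  assumes S: "S \<subseteq> verts G" "S \<noteq> {}" and k: "k \<ge> 3" and val: "barrier_value k G S \<ge> 0"
  obtains (isolated) T where "T \<subseteq> verts G - S" "card T = card S"
      "\<And>u v. u \<in> T \<Longrightarrow> v \<in> verts G - S \<Longrightarrow> \<not> u \<rightarrow> v"
    | (split) A where "A \<subseteq> verts G - S" "3 \<le> card A" "3 \<le> card (verts G - S - A)"
      "\<And>u v. u \<in> A \<Longrightarrow> v \<in> verts G - S - A \<Longrightarrow> \<not> u \<rightarrow> v"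
      "card (verts G) \<ge> 10" "2 * card (verts G - S) \<ge> card (verts G) + 8"
proof -
  define H where "H = delete_verts G S"
  interpret H: graph H
    unfolding H_def by (rule graph_delete_verts)
  have vH: "verts H = verts G - S"
    by (simp add: H_def delete_verts_def)
  define i q where "i = card (isolated_verts H)" and "q = card (odd_vertex_sets H)"
  have "barrier_value k G S = int q + int k * int i - int k * int (card S)"
    by (simp add: barrier_value_def H_def[symmetric] H.num_odd_eq_card num_isolated_def
        isolated_verts_def i_def q_def)
  then have q: "int q \<ge> int k * (int (card S) - int i)"
    using val by (simp add: algebra_simps)
  have dom: "u \<rightarrow>\<^bsub>H\<^esub> v" if "u \<in> verts G - S" "v \<in> verts G - S" "u \<rightarrow> v" for u v
    using that by (simp add: H_def delete_verts_dominates)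
  have cS: "card S + card (verts G - S) = card (verts G)"
    using S by (metis card_Diff_subset card_mono finite_subset finite_verts le_add_diff_inverse)
  show thesis
  proof (cases "card S \<le> i")
    case True
    then obtain T where T: "T \<subseteq> isolated_verts H" "card T = card S"
      unfolding i_def by (metis obtain_subset_with_card_n)
    show ?thesis
    proof (rule isolated[of T])
      show "T \<subseteq> verts G - S"
        using T vH by (auto simp: isolated_verts_def)
      show "\<not> u \<rightarrow> v" if "u \<in> T" "v \<in> verts G - S" for u v
        using dom that T vH unfolding isolated_verts_def by blast
    qed (use T in simp)
  next
    case False
    then have "3 * (int (card S) - int i) \<le> int k * (int (card S) - int i)"
      using k by (intro mult_right_mono) auto
    then have "3 * (int (card S) - int i) \<le> int q"
      using q by (rule order_trans)
    then have "int (3 * card S) \<le> int (q + 3 * i)"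
      by (simp add: algebra_simps)
    then have q3: "3 * card S \<le> q + 3 * i"
      by (simp only: of_nat_le_iff)
    have "3 * q + i \<le> card (verts G - S)"
      using H.odd_isolated_card_le by (simp add: q_def i_def vH)
    \<comment> \<open>With s = \<open>card S\<close> and m = \<open>card (verts G - S)\<close>, the
      facts above give m \<ge> 3q + i \<ge> 9(s - i) + i \<ge> s + 8, because i \<le> s - 1. Both
      bounds follow from s + m = \<open>card (verts G)\<close> and s \<ge> 1.\<close>
    with q3 False cS have num: "card (verts G) \<ge> 10" "2 * card (verts G - S) \<ge> card (verts G) + 8"
      by linarith+
    have "q \<ge> 2"
      using q3 False by linarith
    \<comment> \<open>Two components suffice: \<open>A\<close> is the part to be separated, and
      \<open>B\<close> guarantees three vertices in the remainder.\<close>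
    then obtain A B where AB: "A \<in> odd_vertex_sets H" "B \<in> odd_vertex_sets H" "A \<noteq> B"
      unfolding q_def by (metis card_le_Suc0_iff_eq H.finite_odd_vertex_sets not_less_eq_eq numeral_2_eq_2)
    then have "A \<in> H.sccs_verts" "B \<in> H.sccs_verts"
      using H.odd_vertex_sets_subset by auto
    then have sub: "A \<subseteq> verts G - S" "B \<subseteq> verts G - S" "A \<inter> B = {}"
      using H.sccs_verts_subsets H.sccs_verts_disjoint AB(3) vH by blast+
    then have "card B \<le> card (verts G - S - A)"
      by (intro card_mono) auto
    moreover have "3 \<le> card A" "3 \<le> card B"
      using AB by (simp_all add: odd_vertex_sets_def)
    moreover have "\<not> u \<rightarrow> v" if "u \<in> A" "v \<in> verts G - S - A" for u v
      using that sub(1) dom[of u v] H.odd_vertex_set_closed[OF AB(1), of u v] by blast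
    ultimately show ?thesis
      using sub(1) num by (intro split[of A]) simp_all
  qed
qed

section \<open>Counting edges\<close>

definition edge_set :: "('a, 'b) pre_digraph \<Rightarrow> 'a set set" where
  "edge_set G = (\<lambda>(u, v). {u, v}) ` arcs_ends G"

definition vertex_pairs :: "'a set \<Rightarrow> 'a set set" where
  "vertex_pairs X = {e. e \<subseteq> X \<and> card e = 2}"

lemma card_vertex_pairs: "finite X \<Longrightarrow> card (vertex_pairs X) = card X choose 2"
  by (simp add: vertex_pairs_def n_subsets)

lemma finite_vertex_pairs: "finite X \<Longrightarrow> finite (vertex_pairs X)"
  by (simp add: vertex_pairs_def)

lemma vertex_pairs_mono: "X \<subseteq> Y \<Longrightarrow> vertex_pairs X \<subseteq> vertex_pairs Y"
  by (auto simp: vertex_pairs_def)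

lemma doubleton_in_vertex_pairs: "{u, v} \<in> vertex_pairs X \<longleftrightarrow> u \<in> X \<and> v \<in> X \<and> u \<noteq> v"
  by (auto simp: vertex_pairs_def card_insert_if)

lemma num_edges_eq_card: "num_edges G = card (edge_set G)"
  by (simp add: num_edges_def edge_set_def)

lemma (in graph) doubleton_in_edge_set: "{u, v} \<in> edge_set G \<longleftrightarrow> u \<rightarrow> v"
proof
  assume "{u, v} \<in> edge_set G"
  then have "u \<rightarrow> v \<or> v \<rightarrow> u"
    by (auto simp: edge_set_def doubleton_eq_iff)
  then show "u \<rightarrow> v"
    using sym_arcs by (auto dest: arcs_ends_symmetric)
qed (force simp: edge_set_def)

lemma (in graph) edge_set_subset: "edge_set G \<subseteq> vertex_pairs (verts G)"
  using adj_not_same adj_in_verts by (auto simp: edge_set_def doubleton_in_vertex_pairs)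

text \<open>Outside \<open>M\<close> every pair may be an edge, inside \<open>M\<close> only the
  pairs in \<open>P\<close>; the bound is the size of that largest possible edge set, and equality
  forces \<open>edge_set G\<close> to be all of it. The term \<open>card M choose 2\<close> stands
  on the left to avoid truncated subtraction.\<close>

lemma (in graph)
  assumes M: "M \<subseteq> verts G" and P: "P \<subseteq> vertex_pairs M" and E: "edge_set G \<inter> vertex_pairs M \<subseteq> P"
  shows num_edges_le: "num_edges G + (card M choose 2) \<le> (card (verts G) choose 2) + card P"
    and edge_set_eq: "num_edges G + (card M choose 2) = (card (verts G) choose 2) + card P \<Longrightarrow>
      edge_set G = vertex_pairs (verts G) - vertex_pairs M \<union> P"
proof -
  let ?B = "vertex_pairs (verts G) - vertex_pairs M \<union> P"
  have finM: "finite M"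
    using M by (rule finite_subset) simp
  have finP: "finite P"
    using P finite_vertex_pairs[OF finM] by (rule finite_subset)
  have fin: "finite (vertex_pairs (verts G))"
    by (simp add: finite_vertex_pairs)
  have sub: "vertex_pairs M \<subseteq> vertex_pairs (verts G)"
    using M by (rule vertex_pairs_mono)
  have "card ?B = card (vertex_pairs (verts G) - vertex_pairs M) + card P"
    using fin finP P by (intro card_Un_disjoint) auto
  moreover have "card (vertex_pairs (verts G) - vertex_pairs M) + (card M choose 2) = card (verts G) choose 2"
    using card_Diff_subset[OF finite_vertex_pairs[OF finM] sub] card_mono[OF fin sub] finM
    by (simp add: card_vertex_pairs)
  ultimately have B: "card ?B + (card M choose 2) = (card (verts G) choose 2) + card P"
    by simp
  have EB: "edge_set G \<subseteq> ?B"
    using edge_set_subset E by blast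
  have finB: "finite ?B"
    using fin finP by simp
  show "num_edges G + (card M choose 2) \<le> (card (verts G) choose 2) + card P"
    using card_mono[OF finB EB] B by (simp add: num_edges_eq_card)
  show "edge_set G = ?B"
    if "num_edges G + (card M choose 2) = (card (verts G) choose 2) + card P"
    using card_subset_eq[OF finB EB] B that by (simp add: num_edges_eq_card)
qed

text \<open>This takes \<open>M\<close> to be \<open>verts G - S\<close> and allows only pairs that
  avoid \<open>T\<close> inside it. In the case of equality the adjacency relation is that of the
  join of a complete graph on \<open>S\<close> with a complete graph plus isolated vertices
  \<open>T\<close>.\<close>

lemma (in graph)
  assumes S: "S \<subseteq> verts G" and T: "T \<subseteq> verts G - S"
    and iso: "\<And>u v. u \<in> T \<Longrightarrow> v \<in> verts G - S \<Longrightarrow> \<not> u \<rightarrow> v"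
  defines "n \<equiv> card (verts G)"
  shows num_edges_isolated_le:
      "num_edges G + ((n - card S) choose 2) \<le> (n choose 2) + ((n - card S - card T) choose 2)"
    and adjacent_iff_if_num_edges_isolated_eq:
      "num_edges G + ((n - card S) choose 2) = (n choose 2) + ((n - card S - card T) choose 2) \<Longrightarrow>
        u \<in> verts G \<Longrightarrow> v \<in> verts G \<Longrightarrow>
        u \<rightarrow> v \<longleftrightarrow> u \<noteq> v \<and> (u \<in> S \<or> v \<in> S \<or> u \<notin> T \<and> v \<notin> T)"
proof -
  let ?M = "verts G - S" and ?P = "vertex_pairs (verts G - S - T)"
  have fin: "finite S" "finite T"
    using S T by (auto intro: finite_subset)
  have cM: "card ?M = n - card S"
    using S fin by (simp add: card_Diff_subset n_def)
  have cP: "card ?P = (n - card S - card T) choose 2"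
    using T fin cM by (simp add: card_vertex_pairs card_Diff_subset)
  have PM: "?P \<subseteq> vertex_pairs ?M"
    by (rule vertex_pairs_mono) auto
  have E: "edge_set G \<inter> vertex_pairs ?M \<subseteq> ?P"
  proof
    fix e assume e: "e \<in> edge_set G \<inter> vertex_pairs ?M"
    then obtain u v where uv: "e = {u, v}" "u \<rightarrow> v"
      by (auto simp: edge_set_def)
    then have "v \<rightarrow> u"
      using sym_arcs by (auto dest: arcs_ends_symmetric)
    then show "e \<in> ?P"
      using e uv iso by (auto simp: doubleton_in_vertex_pairs)
  qed
  show "num_edges G + ((n - card S) choose 2) \<le> (n choose 2) + ((n - card S - card T) choose 2)"
    using num_edges_le[OF _ PM E] by (simp add: cM cP n_def)
  show "u \<rightarrow> v \<longleftrightarrow> u \<noteq> v \<and> (u \<in> S \<or> v \<in> S \<or> u \<notin> T \<and> v \<notin> T)"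
    if "num_edges G + ((n - card S) choose 2) = (n choose 2) + ((n - card S - card T) choose 2)"
      and uv: "u \<in> verts G" "v \<in> verts G"
  proof -
    have "edge_set G = vertex_pairs (verts G) - vertex_pairs ?M \<union> ?P"
      using that by (intro edge_set_eq[OF _ PM E]) (simp_all add: cM cP n_def)
    then have "(u \<rightarrow> v) = ({u, v} \<in> vertex_pairs (verts G) - vertex_pairs ?M \<union> ?P)"
      using doubleton_in_edge_set[of u v] by simp
    then show ?thesis
      using uv by (auto simp: doubleton_in_vertex_pairs)
  qed
qed

lemma (in graph) num_edges_split_le:
  assumes M: "M \<subseteq> verts G" and A: "A \<subseteq> M"
    and split: "\<And>u v. u \<in> A \<Longrightarrow> v \<in> M - A \<Longrightarrow> \<not> u \<rightarrow> v"
  shows "num_edges G + (card M choose 2) \<le>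
    (card (verts G) choose 2) + (card A choose 2) + (card (M - A) choose 2)"
proof -
  let ?P = "vertex_pairs A \<union> vertex_pairs (M - A)"
  have "finite M"
    using M by (rule finite_subset) simp
  moreover from this have "finite A"
    using A by (rule finite_subset[rotated])
  ultimately have fin: "finite M" "finite A" .
  have PM: "?P \<subseteq> vertex_pairs M"
    using A vertex_pairs_mono[of A M] vertex_pairs_mono[of "M - A" M] by auto
  have E: "edge_set G \<inter> vertex_pairs M \<subseteq> ?P"
  proof
    fix e assume e: "e \<in> edge_set G \<inter> vertex_pairs M"
    then obtain u v where uv: "e = {u, v}" "u \<rightarrow> v"
      by (auto simp: edge_set_def)
    then have "v \<rightarrow> u"
      using sym_arcs by (auto dest: arcs_ends_symmetric)
    then show "e \<in> ?P"
      using e uv split by (auto simp: doubleton_in_vertex_pairs)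
  qed
  have "card ?P \<le> (card A choose 2) + (card (M - A) choose 2)"
    using card_Un_le[of "vertex_pairs A" "vertex_pairs (M - A)"] fin by (simp add: card_vertex_pairs)
  then show ?thesis
    using num_edges_le[OF M PM E] by linarith
qed

section \<open>Numerical inequalities between binomial coefficients\<close>

text \<open>Doubling and passing to integers turns the bounds into polynomial inequalities, free of
  division and truncated subtraction.\<close>

lemma two_times_choose_two: "2 * int (n choose 2) = int n * (int n - 1)"
  by (induction n) (simp_all add: numeral_2_eq_2 algebra_simps)

text \<open>The assumption says that ab of the n(n - 1)/2 possible edges are missing. As (a - 3)(b -
  3) \<ge> 0, one has ab \<ge> 3(a + b) - 9 \<ge> 3n/2 + 3, which exceeds n - 1, the difference
  between \<open>n choose 2\<close> and \<open>(n - 1) choose 2\<close>.\<close>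

lemma split_bound:
  assumes "e + ((a + b) choose 2) \<le> (n choose 2) + (a choose 2) + (b choose 2)"
    and "a \<ge> 3" "b \<ge> 3" "2 * (a + b) \<ge> n + 8" "n > 0"
  shows "e \<le> (n - 1) choose 2"
proof -
  have "0 \<le> (int a - 3) * (int b - 3)"
    using assms by simp
  then have ab: "int a * int b \<ge> 3 * (int a + int b) - 9"
    by (simp add: algebra_simps)
  show ?thesis
  proof (cases n)
    case (Suc p)
    have "2 * int e + int (a + b) * (int (a + b) - 1) \<le>
        int n * (int n - 1) + int a * (int a - 1) + int b * (int b - 1)"
      using assms(1) unfolding two_times_choose_two[symmetric] by linarith
    then have "2 * int e + 2 * (int a * int b) \<le> int n * (int n - 1)"
      by (simp add: algebra_simps)
    moreover have "int n * (int n - 1) = 2 * int (p choose 2) + 2 * int p"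
      by (simp add: two_times_choose_two Suc algebra_simps)
    ultimately show ?thesis
      using ab assms(4) Suc by simp
  qed (use assms(5) in simp)
qed

lemma isolated_bound_imp_singleton:
  assumes "((n - 1) choose 2) + 1 + ((n - s) choose 2) \<le> (n choose 2) + ((n - s - s) choose 2)"
    and "n \<ge> 10" "s \<ge> 1" "2 * s \<le> n"
  shows "s = 1"
proof (rule ccontr)
  assume "s \<noteq> 1"
  define N S where "N = int n" and "S = int s"
  have conv: "int (n - 1) = N - 1" "int (n - s) = N - S" "int (n - s - s) = N - 2 * S" "int n = N"
    using assms by (auto simp: N_def S_def)
  have "2 * int ((n - 1) choose 2) + 2 + 2 * int ((n - s) choose 2) \<le>
      2 * int (n choose 2) + 2 * int ((n - s - s) choose 2)"
    using assms(1) by linarith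
  \<comment> \<open>The product is twice the slack in the assumed inequality. Its root S = 1 is the
    extremal join; the other factor is negative because S \<le> N/2 and N > 8. At N = 8, S = 4 it
    vanishes, whence the second exception there.\<close>
  then have "0 \<le> (S - 1) * (3 * S + 4 - 2 * N)"
    unfolding two_times_choose_two conv by (simp add: algebra_simps)
  moreover have "S - 1 > 0" "3 * S + 4 - 2 * N < 0"
    using assms \<open>s \<noteq> 1\<close> by (auto simp: N_def S_def)
  then have "(S - 1) * (3 * S + 4 - 2 * N) < 0"
    by (rule mult_pos_neg)
  ultimately show False
    by linarith
qed

text \<open>For s = 1 the extremal join has exactly \<open>((n - 1) choose 2) + 1\<close> edges, so
  the threshold for n \<ge> 10 is attained.\<close>

lemma singleton_bound_eq:
  assumes "n \<ge> 2"
  shows "((n - 1) choose 2) + 1 + ((n - 1) choose 2) = (n choose 2) + ((n - 1 - 1) choose 2)"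
proof -
  obtain p where "n = Suc (Suc p)"
    using assms by (metis add_2_eq_Suc le_Suc_ex)
  then show ?thesis
    by (simp add: numeral_2_eq_2)
qed

section \<open>The extremal graphs\<close>

text \<open>An isomorphism must also map arcs. Without parallel arcs, sending an arc to the pair of
  images of its ends is injective, so a bijection of vertices respecting adjacency suffices.\<close>

lemma (in graph) digraph_iso_pairI:
  assumes f: "bij_betw f (verts G) (pverts P)" and P: "parcs P \<subseteq> pverts P \<times> pverts P"
    and adj: "\<And>u v. u \<in> verts G \<Longrightarrow> v \<in> verts G \<Longrightarrow> u \<rightarrow> v \<longleftrightarrow> (f u, f v) \<in> parcs P"
  shows "digraph_iso G (with_proj P)"
proof -
  define h where "h = \<lparr> iso_verts = f, iso_arcs = (\<lambda>a. (f (tail G a), f (head G a))),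
    iso_head = snd, iso_tail = fst \<rparr>"
  have inj: "inj_on f (verts G)"
    using f by (rule bij_betw_imp_inj_on)
  have "inj_on (iso_arcs h) (arcs G)"
  proof (rule inj_onI)
    fix a b assume ab: "a \<in> arcs G" "b \<in> arcs G" "iso_arcs h a = iso_arcs h b"
    then have "arc_to_ends G a = arc_to_ends G b"
      using inj by (auto simp: h_def arc_to_ends_def dest: inj_onD)
    with ab show "a = b"
      using no_multi_arcs by blast
  qed
  then have "digraph_isomorphism h"
    using inj wf_digraph by (simp add: digraph_isomorphism_def h_def)
  moreover have "with_proj P = app_iso h G"
  proof -
    have "iso_arcs h ` arcs G = (\<lambda>(u, v). (f u, f v)) ` arcs_ends G"
      by (auto simp: h_def arcs_ends_def arc_to_ends_def image_image)
    also have "\<dots> = parcs P"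
    proof (intro equalityI subsetI)
      fix x assume x: "x \<in> parcs P"
      then have "x \<in> f ` verts G \<times> f ` verts G"
        using P f by (auto simp: bij_betw_def)
      then obtain u v where "x = (f u, f v)" "u \<in> verts G" "v \<in> verts G"
        by blast
      moreover from this have "(u, v) \<in> arcs_ends G"
        using x adj[of u v] by simp
      ultimately show "x \<in> (\<lambda>(u, v). (f u, f v)) ` arcs_ends G"
        by (intro image_eqI[where x = "(u, v)"]) simp_all
    next
      fix x assume "x \<in> (\<lambda>(u, v). (f u, f v)) ` arcs_ends G"
      then obtain u v where uv: "x = (f u, f v)" "(u, v) \<in> arcs_ends G"
        by auto
      then have "u \<in> verts G" "v \<in> verts G"
        by (simp_all only: adj_in_verts)
      then show "x \<in> parcs P"
        using uv adj[of u v] by simp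
    qed
    finally show ?thesis
      using f by (simp add: with_proj_def app_iso_def bij_betw_def) (simp add: h_def)
  qed
  ultimately show ?thesis
    by (auto simp: digraph_iso_def)
qed

text \<open>The right-hand side has the form of the adjacency found in the case of equality, with
  \<open>Inl 0\<close> as the vertex of S and \<open>Inr (Inr 0)\<close> as the vertex of T.\<close>

lemma parcs_join_pendant_iff:
  fixes m :: nat
  defines "P \<equiv> graph_join (complete_graph 1) (disjoint_union (complete_graph m) (complete_graph 1))"
  assumes "a \<in> pverts P" "b \<in> pverts P"
  shows "(a, b) \<in> parcs P \<longleftrightarrow>
    a \<noteq> b \<and> (a = Inl 0 \<or> b = Inl 0 \<or> a \<noteq> Inr (Inr 0) \<and> b \<noteq> Inr (Inr 0))"
  using assms(2,3) unfolding P_def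
  by (auto simp: graph_join_def disjoint_union_def complete_graph_def)

lemma parcs_join_empty_iff:
  fixes p q :: nat
  defines "P \<equiv> graph_join (complete_graph p) (empty_graph q)"
  assumes "a \<in> pverts P" "b \<in> pverts P"
  shows "(a, b) \<in> parcs P \<longleftrightarrow> a \<noteq> b \<and> (isl a \<or> isl b)"
  using assms(2,3) unfolding P_def
  by (auto simp: graph_join_def disjoint_union_def complete_graph_def empty_graph_def)

lemma (in graph) digraph_iso_join_pendant:
  assumes xy: "x \<in> verts G" "y \<in> verts G" "x \<noteq> y" and m: "card (verts G) = m + 2"
    and adj: "\<And>u v. u \<in> verts G \<Longrightarrow> v \<in> verts G \<Longrightarrow>
      u \<rightarrow> v \<longleftrightarrow> u \<noteq> v \<and> (u = x \<or> v = x \<or> u \<noteq> y \<and> v \<noteq> y)"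
  shows "digraph_iso G (with_proj (graph_join (complete_graph 1)
    (disjoint_union (complete_graph m) (complete_graph 1))))"
proof -
  let ?P = "graph_join (complete_graph 1) (disjoint_union (complete_graph m) (complete_graph 1))"
  have "card (verts G - {x, y}) = m"
    using xy m by (simp add: card_Diff_subset)
  then obtain g where g: "bij_betw g (verts G - {x, y}) {..<m}"
    by (metis atLeast0LessThan ex_bij_betw_finite_nat finite_Diff finite_verts)
  define f :: "'a \<Rightarrow> nat + (nat + nat)" where
    "f = (\<lambda>u. if u = x then Inl 0 else if u = y then Inr (Inr 0) else Inr (Inl (g u)))"
  have "bij_betw (Inr \<circ> Inl \<circ> g) (verts G - {x, y}) ((Inr \<circ> Inl) ` {..<m})"
    using g by (rule bij_betw_trans) (rule bij_betw_imageI, auto intro: inj_onI)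
  then have "bij_betw f (verts G - {x, y}) ((Inr \<circ> Inl) ` {..<m})"
    by (subst bij_betw_cong[where g = "Inr \<circ> Inl \<circ> g"]) (auto simp: f_def)
  moreover have "bij_betw f {x, y} {Inl 0, Inr (Inr 0)}"
    using xy(3) by (auto simp: bij_betw_def f_def)
  ultimately have "bij_betw f (verts G - {x, y} \<union> {x, y}) ((Inr \<circ> Inl) ` {..<m} \<union> {Inl 0, Inr (Inr 0)})"
    by (rule bij_betw_combine) auto
  moreover have "verts G - {x, y} \<union> {x, y} = verts G"
    using xy by blast
  moreover have "(Inr \<circ> Inl) ` {..<m} \<union> {Inl 0, Inr (Inr 0)} = pverts ?P"
    by (auto simp: graph_join_def disjoint_union_def complete_graph_def)
  ultimately have bij: "bij_betw f (verts G) (pverts ?P)"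
    by (simp only:)
  then show ?thesis
  proof (rule digraph_iso_pairI)
    show "parcs ?P \<subseteq> pverts ?P \<times> pverts ?P"
      by (auto simp: graph_join_def disjoint_union_def complete_graph_def)
    show "u \<rightarrow> v \<longleftrightarrow> (f u, f v) \<in> parcs ?P" if uv: "u \<in> verts G" "v \<in> verts G" for u v
    proof -
      have "f u = f v \<longleftrightarrow> u = v"
        using bij uv by (auto simp: bij_betw_def dest: inj_onD)
      moreover have "f w = Inl 0 \<longleftrightarrow> w = x" "f w = Inr (Inr 0) \<longleftrightarrow> w = y" for w
        using xy(3) by (auto simp: f_def)
      moreover have "f u \<in> pverts ?P" "f v \<in> pverts ?P"
        using bij uv by (auto simp: bij_betw_def)
      ultimately show ?thesis
        by (simp only: adj[OF uv] parcs_join_pendant_iff)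
    qed
  qed
qed

lemma (in graph) digraph_iso_join_empty:
  assumes S: "S \<subseteq> verts G" "card S = p" "card (verts G - S) = q"
    and adj: "\<And>u v. u \<in> verts G \<Longrightarrow> v \<in> verts G \<Longrightarrow> u \<rightarrow> v \<longleftrightarrow> u \<noteq> v \<and> (u \<in> S \<or> v \<in> S)"
  shows "digraph_iso G (with_proj (graph_join (complete_graph p) (empty_graph q)))"
proof -
  let ?P = "graph_join (complete_graph p) (empty_graph q)"
  have "finite S"
    using S(1) by (rule finite_subset) simp
  then obtain g where g: "bij_betw g S {..<p}"
    using S by (metis atLeast0LessThan ex_bij_betw_finite_nat)
  obtain h where h: "bij_betw h (verts G - S) {..<q}"
    using S by (metis atLeast0LessThan ex_bij_betw_finite_nat finite_Diff finite_verts)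
  define f :: "'a \<Rightarrow> nat + nat" where "f = (\<lambda>u. if u \<in> S then Inl (g u) else Inr (h u))"
  have "bij_betw (Inl \<circ> g) S (Inl ` {..<p})"
    using g by (rule bij_betw_trans) (rule bij_betw_imageI, auto)
  then have "bij_betw f S (Inl ` {..<p})"
    by (subst bij_betw_cong[where g = "Inl \<circ> g"]) (auto simp: f_def)
  moreover have "bij_betw (Inr \<circ> h) (verts G - S) (Inr ` {..<q})"
    using h by (rule bij_betw_trans) (rule bij_betw_imageI, auto)
  then have "bij_betw f (verts G - S) (Inr ` {..<q})"
    by (subst bij_betw_cong[where g = "Inr \<circ> h"]) (auto simp: f_def)
  ultimately have "bij_betw f (S \<union> (verts G - S)) (Inl ` {..<p} \<union> Inr ` {..<q})"
    by (intro bij_betw_combine) auto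
  moreover have "S \<union> (verts G - S) = verts G"
    using S(1) by blast
  moreover have "Inl ` {..<p} \<union> Inr ` {..<q} = pverts ?P"
    by (auto simp: graph_join_def complete_graph_def empty_graph_def)
  ultimately have bij: "bij_betw f (verts G) (pverts ?P)"
    by (simp only:)
  then show ?thesis
  proof (rule digraph_iso_pairI)
    show "parcs ?P \<subseteq> pverts ?P \<times> pverts ?P"
      by (auto simp: graph_join_def disjoint_union_def complete_graph_def empty_graph_def)
    show "u \<rightarrow> v \<longleftrightarrow> (f u, f v) \<in> parcs ?P" if uv: "u \<in> verts G" "v \<in> verts G" for u v
    proof -
      have "f u = f v \<longleftrightarrow> u = v"
        using bij uv by (auto simp: bij_betw_def dest: inj_onD)
      moreover have "isl (f w) \<longleftrightarrow> w \<in> S" for w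
        by (simp add: f_def)
      moreover have "f u \<in> pverts ?P" "f v \<in> pverts ?P"
        using bij uv by (auto simp: bij_betw_def)
      ultimately show ?thesis
        by (simp only: adj[OF uv] parcs_join_empty_iff)
    qed
  qed
qed

section \<open>Reduction to an inequality in s, and the three ranges of n\<close>

text \<open>Combines the structural dichotomy for a nonempty set of nonnegative value with the edge
  counts. The characterisation of adjacency is kept conditional on equality, to be used only where
  the hypothesis on the number of edges forces it.\<close>

lemma (in graph) not_GBC_cases:
  assumes "connected G" "even (card (verts G))" "k \<ge> 3" "\<not> GBC k G" and n: "card (verts G) = n"
  obtains (isolated) S T where "S \<subseteq> verts G" "T \<subseteq> verts G - S" "card T = card S"
      "1 \<le> card S" "2 * card S \<le> n"
      "num_edges G + ((n - card S) choose 2) \<le> (n choose 2) + ((n - card S - card S) choose 2)"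
      "\<And>u v. num_edges G + ((n - card S) choose 2) = (n choose 2) + ((n - card S - card S) choose 2) \<Longrightarrow>
        u \<in> verts G \<Longrightarrow> v \<in> verts G \<Longrightarrow>
        u \<rightarrow> v \<longleftrightarrow> u \<noteq> v \<and> (u \<in> S \<or> v \<in> S \<or> u \<notin> T \<and> v \<notin> T)"
    | (split) "n \<ge> 10" "num_edges G \<le> (n - 1) choose 2"
proof -
  obtain S where S: "S \<subseteq> verts G" "S \<noteq> {}" "barrier_value k G S \<ge> 0"
    using GBC_I[OF assms(1,2)] assms(4) by (meson not_less)
  have fS: "finite S"
    using S finite_verts by (auto intro: finite_subset)
  have cS: "card S + card (verts G - S) = n"
    using S fS n by (metis card_Diff_subset card_mono finite_verts le_add_diff_inverse)
  from S(1,2) assms(3) S(3) show thesis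
  proof (cases rule: nonneg_barrier_value_cases)
    case (isolated T)
    have "card T \<le> card (verts G - S)"
      using isolated(1) by (intro card_mono) auto
    then have "2 * card S \<le> n"
      using cS isolated(2) by linarith
    moreover have "1 \<le> card S"
      using S(2) fS by (simp add: Suc_le_eq card_gt_0_iff)
    ultimately show ?thesis
      using S(1) isolated num_edges_isolated_le[OF S(1) isolated(1,3)]
        adjacent_iff_if_num_edges_isolated_eq[OF S(1) isolated(1,3)]
      by (intro that(1)[of S T]) (simp_all add: n)
  next
    case (split A)
    have fin: "finite A"
      using split(1) by (rule finite_subset) simp
    have "card A \<le> card (verts G - S)"
      using split(1) by (intro card_mono) auto
    then have "card (verts G - S) = card A + card (verts G - S - A)"
      using fin split(1) by (simp add: card_Diff_subset)
    then have "num_edges G \<le> (n - 1) choose 2"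
      using num_edges_split_le[OF _ split(1,4)] split(2,3,5,6) n
      by (intro split_bound[of _ "card A" "card (verts G - S - A)"]) simp_all
    then show ?thesis
      using split(5) n by (intro that(2)) simp_all
  qed
qed

theorem theorem4p1:
  fixes G :: "('a, 'b) pre_digraph" and n k :: nat
  assumes "n \<ge> 4" and "even n"
    and "k \<ge> 3" and "odd k"
    and "graph G" and "connected G" and "card (verts G) = n"
  shows
    "(n \<ge> 10 \<and> num_edges G \<ge> ((n - 1) choose 2) + 1 \<longrightarrow>
        \<not> digraph_iso G (with_proj (graph_join (complete_graph 1)
              (disjoint_union (complete_graph (n - 2)) (complete_graph 1)))) \<longrightarrow>
        GBC k G) \<and>
     (4 \<le> n \<and> n \<le> 6 \<and> real (num_edges G) \<ge> (3 * real n ^ 2 - 2 * real n) / 8 \<longrightarrow>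
        \<not> digraph_iso G (with_proj (graph_join (complete_graph (n div 2)) (empty_graph (n div 2)))) \<longrightarrow>
        GBC k G) \<and>
     (n = 8 \<and> num_edges G \<ge> 22 \<longrightarrow>
        \<not> (digraph_iso G (with_proj (graph_join (complete_graph 4) (empty_graph 4))) \<or>
           digraph_iso G (with_proj (graph_join (complete_graph 1)
              (disjoint_union (complete_graph 6) (complete_graph 1))))) \<longrightarrow>
        GBC k G)"
proof -
  interpret graph G
    by fact
  let ?e = "num_edges G"
  let ?bound = "\<lambda>s. (n choose 2) + ((n - s - s) choose 2)"
  let ?K1 = "with_proj (graph_join (complete_graph 1)
    (disjoint_union (complete_graph (n - 2)) (complete_graph 1)))"
  let ?K2 = "with_proj (graph_join (complete_graph (n div 2)) (empty_graph (n div 2)))"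
  \<comment> \<open>Here s is the size of S. Only s = 1 and s = n/2 can attain the edge bound under
    the hypotheses of the three cases, so only these two isomorphisms are recorded.\<close>
  have key: "(n \<ge> 10 \<and> ?e \<le> (n - 1) choose 2) \<or>
      (\<exists>s. 1 \<le> s \<and> 2 * s \<le> n \<and> ?e + ((n - s) choose 2) \<le> ?bound s \<and>
        (?e + ((n - s) choose 2) = ?bound s \<longrightarrow>
          (s = 1 \<longrightarrow> digraph_iso G ?K1) \<and> (s = n div 2 \<longrightarrow> digraph_iso G ?K2)))"
    if "\<not> GBC k G"
  proof -
    have even: "even (card (verts G))"
      using assms by simp
    from assms(6) even assms(3) that assms(7) show ?thesis
    proof (cases rule: not_GBC_cases)
      case (isolated S T)
      have "digraph_iso G ?K1"
        if eq: "?e + ((n - card S) choose 2) = ?bound (card S)" and one: "card S = 1"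
      proof -
        obtain x y where xy: "S = {x}" "T = {y}"
          using one isolated(3) by (metis card_1_singletonE)
        show ?thesis
        proof (rule digraph_iso_join_pendant[of x y])
          show "u \<rightarrow>\<^bsub>G\<^esub> v \<longleftrightarrow> u \<noteq> v \<and> (u = x \<or> v = x \<or> u \<noteq> y \<and> v \<noteq> y)"
            if "u \<in> verts G" "v \<in> verts G" for u v
            using isolated(7)[OF eq that] by (simp add: xy)
        qed (use isolated(1,2) xy assms(1,7) in auto)
      qed
      moreover have "digraph_iso G ?K2"
        if eq: "?e + ((n - card S) choose 2) = ?bound (card S)" and half: "card S = n div 2"
      proof (rule digraph_iso_join_empty[OF isolated(1)])
        have "finite S"
          using isolated(1) by (rule finite_subset) simp
        then have "card (verts G - S) = n - n div 2"
          using isolated(1) half assms(7) by (simp add: card_Diff_subset)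
        then show "card (verts G - S) = n div 2"
          using assms(2) by presburger
        \<comment> \<open>When s = n/2 the set \<open>T\<close> exhausts the complement of
          \<open>S\<close>, so no complete part is left and every edge meets
          \<open>S\<close>.\<close>
        then have "T = verts G - S"
          using isolated(2,3) half by (intro card_subset_eq) auto
        then show "u \<rightarrow>\<^bsub>G\<^esub> v \<longleftrightarrow> u \<noteq> v \<and> (u \<in> S \<or> v \<in> S)"
          if "u \<in> verts G" "v \<in> verts G" for u v
          using isolated(7)[OF eq that] that by auto
      qed (use half in simp)
      ultimately show ?thesis
        using isolated(4-6) by blast
    next
      case split
      then show ?thesis
        by blast
    qed
  qed
  have case1: "GBC k G"
    if n: "n \<ge> 10" and e: "?e \<ge> ((n - 1) choose 2) + 1" and not_iso: "\<not> digraph_iso G ?K1"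
  proof (rule ccontr)
    assume "\<not> GBC k G"
    moreover have "\<not> (n \<ge> 10 \<and> ?e \<le> (n - 1) choose 2)"
      using n e by linarith
    ultimately obtain s where s: "1 \<le> s" "2 * s \<le> n" "?e + ((n - s) choose 2) \<le> ?bound s"
      "?e + ((n - s) choose 2) = ?bound s \<longrightarrow> s \<noteq> 1"
      using key not_iso by blast
    have "((n - 1) choose 2) + 1 + ((n - s) choose 2) \<le> ?bound s"
      using s(3) e by linarith
    then have "s = 1"
      using n s(1,2) by (rule isolated_bound_imp_singleton)
    \<comment> \<open>Together with the upper bound for s = 1 this is equality, which had been
      excluded.\<close>
    moreover have "?e + ((n - 1) choose 2) \<ge> ?bound 1"
      using e singleton_bound_eq[of n] n by linarith
    ultimately show False
      using s by simp
  qed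
  have case2: "GBC k G"
    if n: "4 \<le> n" "n \<le> 6" and e: "real ?e \<ge> (3 * real n ^ 2 - 2 * real n) / 8"
      and not_iso: "\<not> digraph_iso G ?K2"
  proof (rule ccontr)
    assume "\<not> GBC k G"
    moreover have "\<not> (n \<ge> 10 \<and> ?e \<le> (n - 1) choose 2)"
      using n by linarith
    ultimately obtain s where s: "1 \<le> s" "2 * s \<le> n" "?e + ((n - s) choose 2) \<le> ?bound s"
      "?e + ((n - s) choose 2) = ?bound s \<longrightarrow> s \<noteq> n div 2"
      using key not_iso by blast
    \<comment> \<open>The threshold is the number of edges of the join for s = n/2. For n = 4 the
      value s = 1 allows only 4 edges; for n = 6 the values s = 1, 2 allow 11 and 10.\<close>
    have "n = 4 \<and> ?e \<ge> 5 \<or> n = 6 \<and> ?e \<ge> 12"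
    proof -
      have "n = 4 \<or> n = 6"
        using n assms(2) by presburger
      then show ?thesis
        using e by auto
    qed
    then show False
    proof (elim disjE conjE)
      assume n: "n = 4" and e: "?e \<ge> 5"
      have "s = 1 \<or> s = 2"
        using s n by linarith
      then show False
        using s e n by (auto simp: choose_two)
    next
      assume n: "n = 6" and e: "?e \<ge> 12"
      have "s = 1 \<or> s = 2 \<or> s = 3"
        using s n by linarith
      then show False
        using s e n by (auto simp: choose_two)
    qed
  qed
  have case3: "GBC k G"
    if n: "n = 8" and e: "?e \<ge> 22" and not_iso: "\<not> digraph_iso G ?K2" "\<not> digraph_iso G ?K1"
  proof (rule ccontr)
    assume "\<not> GBC k G"
    moreover have "\<not> (n \<ge> 10 \<and> ?e \<le> (n - 1) choose 2)"
      using n by linarith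
    ultimately obtain s where s: "1 \<le> s" "2 * s \<le> n" "?e + ((n - s) choose 2) \<le> ?bound s"
      "?e + ((n - s) choose 2) = ?bound s \<longrightarrow> s \<noteq> 1 \<and> s \<noteq> n div 2"
      using key not_iso by blast
    \<comment> \<open>The four bounds are 22, 19, 19 and 22 edges, so both ends of the range attain
      the threshold and both graphs are exceptions.\<close>
    have "s = 1 \<or> s = 2 \<or> s = 3 \<or> s = 4"
      using s n by linarith
    then show False
      using s e n by (auto simp: choose_two)
  qed
  show ?thesis
    using case1 case2 case3 by auto
qed

end
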